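(* Any complemented semiring is classical.
   Context: A semiring is an algebraic structure $(S,+,\cdot,0,1)$ such that $(S,+,0)$ and $(S,\cdot,1)$ are commutative monoids, multiplication distributes over addition, and $s\cdot 0=0$ for all $s\in S$. An element $s$ of a semiring $S$ is complemented if there is an element $s^*\in S$ such that $ss^*=0$ and $s+s^*=1$; a semiring is complemented if each of its elements is complemented. An element $s\in S$ is a unit if $st=1$ for some $t\in S$; it is a zero-divisor if $sx=0$ for some nonzero $x\in S$. A semiring is classical if each of its elements is either a unit or a zero-divisor. *)

theory Defs
  imports "HOL-Algebra.Ring"
begin

text \<open>
  The library locale \<^locale>\<open>semiring\<close> does not require multiplication to be commutative.
  Nothing below excludes the trivial semiring, in which zero and one coincide.
\<close>

locale commutative_semiring = semiring S + comm_monoid S for S (structure)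

definition complemented_element :: "('a, 'b) ring_scheme \<Rightarrow> 'a \<Rightarrow> bool" where
  "complemented_element S s \<longleftrightarrow>
     (\<exists>t \<in> carrier S. s \<otimes>\<^bsub>S\<^esub> t = \<zero>\<^bsub>S\<^esub> \<and> s \<oplus>\<^bsub>S\<^esub> t = \<one>\<^bsub>S\<^esub>)"

definition complemented_semiring :: "('a, 'b) ring_scheme \<Rightarrow> bool" where
  "complemented_semiring S \<longleftrightarrow> (\<forall>s \<in> carrier S. complemented_element S s)"

definition zero_divisor :: "('a, 'b) ring_scheme \<Rightarrow> 'a \<Rightarrow> bool" where
  "zero_divisor S s \<longleftrightarrow> (\<exists>x \<in> carrier S. x \<noteq> \<zero>\<^bsub>S\<^esub> \<and> s \<otimes>\<^bsub>S\<^esub> x = \<zero>\<^bsub>S\<^esub>)"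

text \<open>
  \<^const>\<open>Units\<close> asks for a two-sided inverse, which in a commutative semiring is the same as
  \<open>s \<otimes> t = \<one>\<close> for some \<open>t\<close>. The disjunction need not be made exclusive: a unit is never
  a zero-divisor.
\<close>

definition classical_semiring :: "('a, 'b) ring_scheme \<Rightarrow> bool" where
  "classical_semiring S \<longleftrightarrow> (\<forall>s \<in> carrier S. s \<in> Units S \<or> zero_divisor S s)"

end

theory Submission
  imports Defs
begin

theorem theorem3p7:
  fixes S :: "('a, 'b) ring_scheme"
  assumes "commutative_semiring S"
    and "complemented_semiring S"
  shows "classical_semiring S"
  unfolding classical_semiring_def
proof
  interpret commutative_semiring S by fact
  fix s assume s: "s \<in> carrier S"
  with assms(2) obtain t where t: "t \<in> carrier S"
    and annihilates: "s \<otimes>\<^bsub>S\<^esub> t = \<zero>\<^bsub>S\<^esub>" and sum_one: "s \<oplus>\<^bsub>S\<^esub> t = \<one>\<^bsub>S\<^esub>"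
    unfolding complemented_semiring_def complemented_element_def by blast
  show "s \<in> Units S \<or> zero_divisor S s"
  proof (cases "t = \<zero>\<^bsub>S\<^esub>")
    case True
    with sum_one s have "s = \<one>\<^bsub>S\<^esub>" by simp
    then show ?thesis by simp
  next
    (* The complement itself witnesses that s is a zero-divisor. *)
    case False
    with t annihilates show ?thesis unfolding zero_divisor_def by blast
  qed
qed

end
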